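(* Let $b: S^6\to S^3$ be the Blakers-Massey map defined in the context, and let $b^{12}: S^6\to S^3$ be its pointwise 12th power, $b^{12}(p,w)=(b(p,w))^{12}$. There exists no differentiable homotopy $\phi:[0,1]\times S^6\to S^3$ between $b^{12}$ and a constant map such that for each $t\in[0,1]$ the map $\phi(t,\cdot): S^6\to S^3$ is $SO(3)$-equivariant.
   Context: $\mathbb{H}$ denotes the quaternions, and $S^3\subset\mathbb{H}$ is the group of unit quaternions. The 6-sphere is $$S^6=\{(p,w)\in\mathbb{H}\times\mathbb{H} : \mathrm{Re}(p)=0,\ |p|^2+|w|^2=1\}.$$ For a purely imaginary quaternion $x$, $e^x=\cos(|x|)+\sin(|x|)\frac{x}{|x|}$ (with $e^0=1$). The map $b: S^6\to S^3$ is defined by $$b(p,w)=\frac{w}{|w|}\,e^{\pi p}\,\frac{\bar w}{|w|}\ \text{ if } w\neq 0,\qquad b(p,w)=-1\ \text{ if } w=0$$ (this map is known to be analytic and to generate $\pi_6(S^3)\cong\mathbb{Z}_{12}$). Identify $SO(3)=S^3/\{\pm1\}$. The group $SO(3)$ acts on $S^6$ by $[q]\cdot(p,w)=(q p\bar q,\ q w\bar q)$ and on $S^3$ by conjugation, $[q]\cdot x=q x\bar q$, for $q\in S^3$. A map $f: S^6\to S^3$ is $SO(3)$-equivariant if $f(qp\bar q,qw\bar q)=q f(p,w)\bar q$ for all $q\in S^3$ and $(p,w)\in S^6$. *)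

theory Defs
  imports "HOL-Analysis.Analysis"
begin

text \<open>\<open>Quat a b c d\<close> is the quaternion \<open>a + b i + c j + d k\<close>.\<close>

datatype quat = Quat (qre: real) (qim1: real) (qim2: real) (qim3: real)

lemma quat_eq_iff:
  "x = y \<longleftrightarrow> qre x = qre y \<and> qim1 x = qim1 y \<and> qim2 x = qim2 y \<and> qim3 x = qim3 y"
  by (cases x; cases y) simp

instantiation quat :: ab_group_add
begin

definition zero_quat :: quat where "0 = Quat 0 0 0 0"
definition plus_quat :: "quat \<Rightarrow> quat \<Rightarrow> quat" where
  "x + y = Quat (qre x + qre y) (qim1 x + qim1 y) (qim2 x + qim2 y) (qim3 x + qim3 y)"
definition minus_quat :: "quat \<Rightarrow> quat \<Rightarrow> quat" where
  "x - y = Quat (qre x - qre y) (qim1 x - qim1 y) (qim2 x - qim2 y) (qim3 x - qim3 y)"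
definition uminus_quat :: "quat \<Rightarrow> quat" where
  "- x = Quat (- qre x) (- qim1 x) (- qim2 x) (- qim3 x)"

instance
  by standard (simp_all add: quat_eq_iff zero_quat_def plus_quat_def minus_quat_def uminus_quat_def)

end

lemma quat_add_sel [simp]:
  "qre (x + y) = qre x + qre y" "qim1 (x + y) = qim1 x + qim1 y"
  "qim2 (x + y) = qim2 x + qim2 y" "qim3 (x + y) = qim3 x + qim3 y"
  "qre (x - y) = qre x - qre y" "qim1 (x - y) = qim1 x - qim1 y"
  "qim2 (x - y) = qim2 x - qim2 y" "qim3 (x - y) = qim3 x - qim3 y"
  "qre (- x) = - qre x" "qim1 (- x) = - qim1 x"
  "qim2 (- x) = - qim2 x" "qim3 (- x) = - qim3 x"
  "qre 0 = 0" "qim1 0 = 0" "qim2 0 = 0" "qim3 0 = 0"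
  by (simp_all add: zero_quat_def plus_quat_def minus_quat_def uminus_quat_def)

instantiation quat :: ring_1
begin

definition one_quat :: quat where "1 = Quat 1 0 0 0"

text \<open>The product determined by \<open>i\<^sup>2 = j\<^sup>2 = k\<^sup>2 = i j k = -1\<close>.\<close>

definition times_quat :: "quat \<Rightarrow> quat \<Rightarrow> quat" where
  "x * y = Quat
     (qre x * qre y - qim1 x * qim1 y - qim2 x * qim2 y - qim3 x * qim3 y)
     (qre x * qim1 y + qim1 x * qre y + qim2 x * qim3 y - qim3 x * qim2 y)
     (qre x * qim2 y - qim1 x * qim3 y + qim2 x * qre y + qim3 x * qim1 y)
     (qre x * qim3 y + qim1 x * qim2 y - qim2 x * qim1 y + qim3 x * qre y)"

instance
  by standard (simp_all add: quat_eq_iff one_quat_def times_quat_def algebra_simps)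

end

lemma quat_mult_sel [simp]:
  "qre (x * y) = qre x * qre y - qim1 x * qim1 y - qim2 x * qim2 y - qim3 x * qim3 y"
  "qim1 (x * y) = qre x * qim1 y + qim1 x * qre y + qim2 x * qim3 y - qim3 x * qim2 y"
  "qim2 (x * y) = qre x * qim2 y - qim1 x * qim3 y + qim2 x * qre y + qim3 x * qim1 y"
  "qim3 (x * y) = qre x * qim3 y + qim1 x * qim2 y - qim2 x * qim1 y + qim3 x * qre y"
  "qre 1 = 1" "qim1 1 = 0" "qim2 1 = 0" "qim3 1 = 0"
  by (simp_all add: one_quat_def times_quat_def)

instantiation quat :: real_algebra_1
begin

definition scaleR_quat :: "real \<Rightarrow> quat \<Rightarrow> quat" where
  "r *\<^sub>R x = Quat (r * qre x) (r * qim1 x) (r * qim2 x) (r * qim3 x)"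

instance
  by standard (simp_all add: quat_eq_iff scaleR_quat_def algebra_simps)

end

lemma quat_scaleR_sel [simp]:
  "qre (r *\<^sub>R x) = r * qre x" "qim1 (r *\<^sub>R x) = r * qim1 x"
  "qim2 (r *\<^sub>R x) = r * qim2 x" "qim3 (r *\<^sub>R x) = r * qim3 x"
  by (simp_all add: scaleR_quat_def)

instantiation quat :: real_inner
begin

definition inner_quat :: "quat \<Rightarrow> quat \<Rightarrow> real" where
  "x \<bullet> y = qre x * qre y + qim1 x * qim1 y + qim2 x * qim2 y + qim3 x * qim3 y"
definition norm_quat :: "quat \<Rightarrow> real" where
  "norm x = sqrt ((qre x)\<^sup>2 + (qim1 x)\<^sup>2 + (qim2 x)\<^sup>2 + (qim3 x)\<^sup>2)"
definition sgn_quat :: "quat \<Rightarrow> quat" where "sgn x = (x::quat) /\<^sub>R norm x"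
definition dist_quat :: "quat \<Rightarrow> quat \<Rightarrow> real" where "dist x y = norm (x - y :: quat)"
definition uniformity_quat :: "(quat \<times> quat) filter" where
  "uniformity = (INF e\<in>{0<..}. principal {(x :: quat, y). dist x y < e})"
definition open_quat :: "quat set \<Rightarrow> bool" where
  "open (U :: quat set) \<longleftrightarrow> (\<forall>x\<in>U. eventually (\<lambda>(x', y). x' = x \<longrightarrow> y \<in> U) uniformity)"

instance
proof
  fix x :: quat
  show "0 \<le> x \<bullet> x" by (simp add: inner_quat_def)
  show "x \<bullet> x = 0 \<longleftrightarrow> x = 0"
  proof
    assume "x \<bullet> x = 0"
    then have s: "(qre x)\<^sup>2 + (qim1 x)\<^sup>2 + (qim2 x)\<^sup>2 + (qim3 x)\<^sup>2 = 0"
      by (simp add: inner_quat_def power2_eq_square)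
    then have "(qre x)\<^sup>2 = 0 \<and> (qim1 x)\<^sup>2 = 0 \<and> (qim2 x)\<^sup>2 = 0 \<and> (qim3 x)\<^sup>2 = 0"
      using zero_le_power2[of "qre x"] zero_le_power2[of "qim1 x"]
        zero_le_power2[of "qim2 x"] zero_le_power2[of "qim3 x"] by linarith
    then show "x = 0" by (simp add: quat_eq_iff)
  qed (simp add: inner_quat_def)
  show "norm x = sqrt (x \<bullet> x)" by (simp add: norm_quat_def inner_quat_def power2_eq_square)
qed (simp_all add: inner_quat_def sgn_quat_def dist_quat_def uniformity_quat_def
      open_quat_def algebra_simps)

end

lemma quat_norm_mult: "norm (x * y) = norm x * norm (y :: quat)"
  unfolding norm_quat_def real_sqrt_mult[symmetric] quat_mult_sel
  by (rule arg_cong[where f = sqrt]) algebra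

instance quat :: real_normed_algebra_1
  by standard (simp_all add: quat_norm_mult, simp add: norm_quat_def)

definition qcnj :: "quat \<Rightarrow> quat" where
  "qcnj x = Quat (qre x) (- qim1 x) (- qim2 x) (- qim3 x)"

lemma qcnj_mult_self:
  "qcnj x * x = (norm x)\<^sup>2 *\<^sub>R 1" "x * qcnj x = (norm x)\<^sup>2 *\<^sub>R 1"
  by (simp_all add: quat_eq_iff qcnj_def norm_quat_def power2_eq_square)

instantiation quat :: real_normed_div_algebra
begin

definition inverse_quat :: "quat \<Rightarrow> quat" where
  "inverse x = inverse ((norm x)\<^sup>2) *\<^sub>R qcnj (x :: quat)"
definition divide_quat :: "quat \<Rightarrow> quat \<Rightarrow> quat" where
  "x div y = x * (inverse ((norm y)\<^sup>2) *\<^sub>R qcnj (y :: quat))"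

instance
proof
  fix x y :: quat
  show "inverse x * x = 1" if "x \<noteq> 0"
    using that unfolding inverse_quat_def mult_scaleR_left qcnj_mult_self by simp
  show "x * inverse x = 1" if "x \<noteq> 0"
    using that unfolding inverse_quat_def mult_scaleR_right qcnj_mult_self by simp
  show "x div y = x * inverse y" unfolding divide_quat_def inverse_quat_def ..
  show "inverse (0::quat) = 0" unfolding inverse_quat_def by simp
  show "norm (x * y) = norm x * norm y" by (rule quat_norm_mult)
qed

end

instantiation quat :: euclidean_space
begin

definition Basis_quat :: "quat set" where
  "Basis = {Quat 1 0 0 0, Quat 0 1 0 0, Quat 0 0 1 0, Quat 0 0 0 1}"

instance
proof
  show "(Basis :: quat set) \<noteq> {}" "finite (Basis :: quat set)"
    by (simp_all add: Basis_quat_def)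
  show "u \<bullet> v = (if u = v then 1 else 0)" if "u \<in> Basis" "v \<in> Basis" for u v :: quat
    using that unfolding Basis_quat_def by (elim insertE emptyE) (simp_all add: inner_quat_def)
  show "(\<forall>u\<in>Basis. x \<bullet> u = 0) \<longleftrightarrow> x = 0" for x :: quat
    by (cases x) (simp add: Basis_quat_def inner_quat_def zero_quat_def)
qed

end

abbreviation S3 :: "quat set" where
  "S3 \<equiv> sphere 0 1"

definition S6 :: "(quat \<times> quat) set" where
  "S6 = {(p, w). qre p = 0 \<and> (norm p)\<^sup>2 + (norm w)\<^sup>2 = 1}"

text \<open>Only used for purely imaginary \<open>x\<close>. Since \<open>0 / 0 = 0\<close>, the value at \<open>0\<close> is \<open>1\<close>.\<close>

definition exp_im :: "quat \<Rightarrow> quat" where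
  "exp_im x = of_real (cos (norm x)) + sin (norm x) *\<^sub>R (x /\<^sub>R norm x)"

definition blakers_massey :: "quat \<times> quat \<Rightarrow> quat" where
  "blakers_massey = (\<lambda>(p, w).
     if w = 0 then - 1
     else (w /\<^sub>R norm w) * exp_im (pi *\<^sub>R p) * (qcnj w /\<^sub>R norm w))"

text \<open>The group \<open>SO(3)\<close> is \<open>S3\<close> modulo \<open>{1, -1}\<close>; both actions below are trivial on \<open>-1\<close>,
  so equivariance is expressed with representatives in \<open>S3\<close>.\<close>

definition SO3_equivariant :: "(quat \<times> quat \<Rightarrow> quat) \<Rightarrow> bool" where
  "SO3_equivariant f \<longleftrightarrow>
     (\<forall>q\<in>S3. \<forall>(p, w)\<in>S6. f (q * p * qcnj q, q * w * qcnj q) = q * f (p, w) * qcnj q)"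

text \<open>Differentiability is joint in time and space, and taken within the subset
  \<open>[0,1] \<times> X\<close> of the ambient normed space. For an embedded submanifold \<open>X\<close> this is
  the same as differentiability in charts, since a submanifold is locally a smooth retract of
  the ambient space. No continuity of the derivative is required.\<close>

definition differentiable_homotopy ::
    "'a::real_normed_vector set \<Rightarrow> 'b::real_normed_vector set \<Rightarrow>
     ('a \<Rightarrow> 'b) \<Rightarrow> ('a \<Rightarrow> 'b) \<Rightarrow> (real \<times> 'a \<Rightarrow> 'b) \<Rightarrow> bool" where
  "differentiable_homotopy X Y f g \<phi> \<longleftrightarrow>
     \<phi> differentiable_on ({0..1} \<times> X) \<and>
     \<phi> \<in> {0..1} \<times> X \<rightarrow> Y \<and>
     (\<forall>x\<in>X. \<phi> (0, x) = f x) \<and>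
     (\<forall>x\<in>X. \<phi> (1, x) = g x)"

end

theory Submission
  imports Defs
begin

text \<open>An equivariant map into \<open>S3\<close> sends a point to a quaternion fixed by the isotropy group of
  that point. The points \<open>(a i, w)\<close> of \<open>S6\<close> with \<open>a \<ge> 0\<close>, \<open>w = x + y i + z j\<close> and \<open>z \<ge> 0\<close> form
  a 3-ball whose boundary points all have isotropy containing a rotation about an axis in the
  \<open>i, j\<close>-plane, so there the \<open>k\<close>-component of an equivariant map vanishes. Hence the degree of
  the restriction over the hemisphere \<open>k > 0\<close> is an invariant of equivariant homotopy. It is zero
  for a constant map, and positive for the twelfth power of the Blakers-Massey map, which on this
  ball is \<open>cos (12 \<pi> a) + sin (12 \<pi> a) \<omega>(w)\<close> with a Hopf map \<open>\<omega>\<close>. Invariance of the degree is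
  Stokes' theorem for a 3-form near \<open>k = 1\<close>, after a Weierstrass approximation that leaves both
  ends of the homotopy unchanged.\<close>

section \<open>Trigonometric polynomial expressions\<close>

text \<open>Functions of the coordinates are kept as syntax, so that every partial derivative is
  again an expression and derivatives of any order exist and are continuous. Variable 0 is time;
  variables 1, 2, 3 are the spatial parameters.\<close>

datatype texp = Const real | Var nat | Add texp texp | Mult texp texp | Sin texp | Cos texp

primrec eval_texp :: "texp \<Rightarrow> (nat \<Rightarrow> real) \<Rightarrow> real" where
  "eval_texp (Const c) v = c"
| "eval_texp (Var i) v = v i"
| "eval_texp (Add e f) v = eval_texp e v + eval_texp f v"
| "eval_texp (Mult e f) v = eval_texp e v * eval_texp f v"
| "eval_texp (Sin e) v = sin (eval_texp e v)"
| "eval_texp (Cos e) v = cos (eval_texp e v)"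

primrec pd :: "nat \<Rightarrow> texp \<Rightarrow> texp" where
  "pd i (Const c) = Const 0"
| "pd i (Var j) = Const (if i = j then 1 else 0)"
| "pd i (Add e f) = Add (pd i e) (pd i f)"
| "pd i (Mult e f) = Add (Mult (pd i e) f) (Mult e (pd i f))"
| "pd i (Sin e) = Mult (Cos e) (pd i e)"
| "pd i (Cos e) = Mult (Const (-1)) (Mult (Sin e) (pd i e))"

primrec fix_time :: "real \<Rightarrow> texp \<Rightarrow> texp" where
  "fix_time \<tau> (Const c) = Const c"
| "fix_time \<tau> (Var j) = (if j = 0 then Const \<tau> else Var j)"
| "fix_time \<tau> (Add e f) = Add (fix_time \<tau> e) (fix_time \<tau> f)"
| "fix_time \<tau> (Mult e f) = Mult (fix_time \<tau> e) (fix_time \<tau> f)"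
| "fix_time \<tau> (Sin e) = Sin (fix_time \<tau> e)"
| "fix_time \<tau> (Cos e) = Cos (fix_time \<tau> e)"

lemma eval_fix_time [simp]: "eval_texp (fix_time \<tau> e) v = eval_texp e (v(0 := \<tau>))"
  by (induction e) auto

lemma has_real_derivative_eval_texp:
  "((\<lambda>s. eval_texp e (v(i := s))) has_real_derivative eval_texp (pd i e) (v(i := s))) (at s)"
  by (induction e) (auto intro!: derivative_eq_intros)

lemma continuous_on_eval_texp [continuous_intros]: "continuous_on A (eval_texp e)"
proof (induction e)
  case (Var i)
  have "continuous_on A (\<lambda>v::nat \<Rightarrow> real. v i)"
    by (rule continuous_on_subset[OF continuous_on_product_coordinates subset_UNIV])
  then show ?case by simp
qed (auto intro!: continuous_intros)

text \<open>Symmetry of second derivatives becomes an algebraic induction on the syntax; no analysis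
  enters.\<close>

lemma eval_pd_commute: "eval_texp (pd i (pd j e)) v = eval_texp (pd j (pd i e)) v"
  by (induction e) (auto simp: algebra_simps)

text \<open>Moving variable \<open>i\<close> with \<open>i \<noteq> 0\<close> stays inside the slice
  where variable 0 equals \<open>\<tau>\<close>, so agreement on that slice determines the spatial
  derivatives there.\<close>

lemma eval_pd_fixed_time_cong:
  assumes "\<And>v. eval_texp e (v(0 := \<tau>)) = eval_texp f (v(0 := \<tau>))" and "i \<noteq> 0"
  shows "eval_texp (pd i e) (v(0 := \<tau>)) = eval_texp (pd i f) (v(0 := \<tau>))"
proof -
  have "(v(0 := \<tau>))(i := s) = (v(i := s))(0 := \<tau>)" for s
    using assms(2) by auto
  then have "(\<lambda>s. eval_texp e ((v(0 := \<tau>))(i := s))) = (\<lambda>s. eval_texp f ((v(0 := \<tau>))(i := s)))"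
    using assms(1) by presburger
  then show ?thesis
    using has_real_derivative_eval_texp[of e "v(0 := \<tau>)" i "v i"]
      has_real_derivative_eval_texp[of f "v(0 := \<tau>)" i "v i"] assms(2)
    by (simp add: DERIV_unique fun_upd_idem)
qed

text \<open>Brings the approximants supplied by the Stone-Weierstrass theorem into the
  syntax.\<close>

lemma real_polynomial_function_texp:
  fixes p :: "real \<times> real \<times> real \<times> real \<Rightarrow> real"
  assumes "real_polynomial_function p"
  shows "\<exists>e. \<forall>v. eval_texp e v = p (v 0, v 1, v 2, v 3)"
  using assms
proof (induction rule: real_polynomial_function.induct)
  case (linear f)
  interpret bounded_linear f by fact
  let ?e = "Add (Mult (Const (f (1,0,0,0))) (Var 0)) (Add (Mult (Const (f (0,1,0,0))) (Var 1))
    (Add (Mult (Const (f (0,0,1,0))) (Var 2)) (Mult (Const (f (0,0,0,1))) (Var 3))))"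
  have "f (a, b, c, d) = f (1,0,0,0) * a + (f (0,1,0,0) * b + (f (0,0,1,0) * c + f (0,0,0,1) * d))"
    for a b c d
  proof -
    have "(a, b, c, d) = a *\<^sub>R (1,0,0,0) + (b *\<^sub>R (0,1,0,0) + (c *\<^sub>R (0,0,1,0) + d *\<^sub>R (0,0,0,1)))"
      by simp
    then show ?thesis by (simp only: add scaleR) simp
  qed
  from this[symmetric] have "\<forall>v. eval_texp ?e v = f (v 0, v 1, v 2, v 3)"
    by (simp only: eval_texp.simps) simp
  then show ?case by blast
next
  case (const c)
  have "\<forall>v. eval_texp (Const c) v = c" by simp
  then show ?case by blast
next
  case (add f g)
  then obtain d e where "\<forall>v. eval_texp d v = f (v 0, v 1, v 2, v 3)"
    "\<forall>v. eval_texp e v = g (v 0, v 1, v 2, v 3)" by blast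
  then have "\<forall>v. eval_texp (Add d e) v = f (v 0, v 1, v 2, v 3) + g (v 0, v 1, v 2, v 3)"
    by (simp only: eval_texp.simps) simp
  then show ?case by blast
next
  case (mult f g)
  then obtain d e where "\<forall>v. eval_texp d v = f (v 0, v 1, v 2, v 3)"
    "\<forall>v. eval_texp e v = g (v 0, v 1, v 2, v 3)" by blast
  then have "\<forall>v. eval_texp (Mult d e) v = f (v 0, v 1, v 2, v 3) * g (v 0, v 1, v 2, v 3)"
    by (simp only: eval_texp.simps) simp
  then show ?case by blast
qed

section \<open>Integration over coordinates\<close>

text \<open>The result is again a function of all coordinates, constant in the \<open>i\<close>-th.
  Iterated integrals are thus compositions of operators, and Fubini says that these operators
  commute.\<close>

definition coord_int :: "nat \<Rightarrow> ((nat \<Rightarrow> real) \<Rightarrow> real) \<Rightarrow> (nat \<Rightarrow> real) \<Rightarrow> real" where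
  "coord_int i f v = integral {0..1} (\<lambda>s. f (v(i := s)))"

definition cube :: "(nat \<Rightarrow> real) set" where
  "cube = {v. \<forall>i. v i \<in> {0..1}}"

lemma cube_upd: "v \<in> cube \<Longrightarrow> s \<in> {0..1} \<Longrightarrow> v(i := s) \<in> cube"
  by (auto simp: cube_def)

lemma continuous_on_fun_upd:
  fixes g :: "'a::topological_space \<Rightarrow> nat \<Rightarrow> real"
  assumes "continuous_on S g" "continuous_on S h"
  shows "continuous_on S (\<lambda>x. (g x)(i := h x))"
proof (rule continuous_on_coordinatewise_then_product)
  fix j
  show "continuous_on S (\<lambda>x. ((g x)(i := h x)) j)"
    using assms by (cases "j = i") (auto intro: continuous_on_product_then_coordinatewise)
qed

lemma continuous_on_compose_fun_upd:
  fixes f :: "(nat \<Rightarrow> real) \<Rightarrow> real" and g :: "'a::topological_space \<Rightarrow> nat \<Rightarrow> real"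
  assumes "continuous_on UNIV f" "continuous_on S g" "continuous_on S h"
  shows "continuous_on S (\<lambda>x. f ((g x)(i := h x)))"
  by (rule continuous_on_compose2[OF assms(1) continuous_on_fun_upd[OF assms(2,3)]]) auto

lemma coord_int_integrable:
  fixes f :: "(nat \<Rightarrow> real) \<Rightarrow> real"
  assumes "continuous_on UNIV f"
  shows "(\<lambda>s. f (v(i := s))) integrable_on {0..1}"
  by (rule integrable_continuous_interval)
    (intro continuous_on_compose_fun_upd assms continuous_intros)

lemma continuous_on_coord_int [continuous_intros]:
  assumes "continuous_on UNIV f"
  shows "continuous_on UNIV (coord_int i f)"
proof -
  have "continuous_on (UNIV \<times> cbox 0 1) (\<lambda>(v, s). f (v(i := s)))"
    unfolding split_beta
    by (intro continuous_on_compose_fun_upd assms continuous_intros)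
  then have "continuous_on UNIV (\<lambda>v. integral (cbox 0 1) (\<lambda>s. f (v(i := s))))"
    by (rule integral_continuous_on_param)
  then show ?thesis by (simp add: coord_int_def[abs_def])
qed

lemma coord_int_commute:
  assumes "continuous_on UNIV f" "i \<noteq> j"
  shows "coord_int i (coord_int j f) = coord_int j (coord_int i f)"
proof
  fix v
  have tw: "v(i := s, j := r) = v(j := r, i := s)" for s r :: real
    using assms(2) by (rule fun_upd_twist)
  have "continuous_on (cbox (0, 0) (1, 1)) (\<lambda>(s, r). f (v(i := s, j := r)))"
    unfolding split_beta
    by (intro continuous_on_compose_fun_upd continuous_on_fun_upd assms continuous_intros)
  then have "integral (cbox 0 1) (\<lambda>s. integral (cbox 0 1) (\<lambda>r. f (v(i := s, j := r)))) =
    integral (cbox 0 1) (\<lambda>r. integral (cbox 0 1) (\<lambda>s. f (v(i := s, j := r))))"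
    by (rule integral_swap_continuous)
  then show "coord_int i (coord_int j f) v = coord_int j (coord_int i f) v"
    by (simp add: coord_int_def tw)
qed

lemma coord_int_cong:
  assumes "\<And>v. v \<in> cube \<Longrightarrow> f v = g v" "v \<in> cube"
  shows "coord_int i f v = coord_int i g v"
  unfolding coord_int_def by (intro integral_cong assms(1) cube_upd assms(2))

lemma coord_int_sum:
  assumes "finite A" "\<And>l. continuous_on UNIV (f l)"
  shows "coord_int i (\<lambda>v. \<Sum>l\<in>A. f l v) = (\<lambda>v. \<Sum>l\<in>A. coord_int i (f l) v)"
  unfolding coord_int_def by (intro ext integral_sum coord_int_integrable assms)

lemma coord_int_0 [simp]: "coord_int i (\<lambda>v. 0) = (\<lambda>v. 0)"
  by (simp add: coord_int_def[abs_def])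

lemma coord_int_eq_0:
  assumes "\<And>v. v \<in> cube \<Longrightarrow> f v = 0" "v \<in> cube"
  shows "coord_int i f v = 0"
  using coord_int_cong[of f "\<lambda>_. 0", OF assms, of i] by simp

lemma coord_int_FTC:
  assumes "\<And>v s. ((\<lambda>s. f (v(i := s))) has_real_derivative g (v(i := s))) (at s)"
  shows "coord_int i g v = f (v(i := 1)) - f (v(i := 0))"
proof -
  have "((\<lambda>s. g (v(i := s))) has_integral (f (v(i := 1)) - f (v(i := 0)))) {0..1}"
    by (rule fundamental_theorem_of_calculus)
      (auto intro: has_field_derivative_at_within assms
        simp del: fun_upd_apply simp flip: has_real_derivative_iff_has_vector_derivative)
  then show ?thesis by (simp add: coord_int_def integral_unique)
qed

lemma coord_int_nonneg:
  assumes "continuous_on UNIV f" "\<And>v. v \<in> cube \<Longrightarrow> 0 \<le> f v" "v \<in> cube"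
  shows "0 \<le> coord_int i f v"
  unfolding coord_int_def
  by (rule integral_nonneg) (auto intro!: coord_int_integrable assms cube_upd)

text \<open>A continuous nonnegative function with zero integral vanishes on the whole line segment,
  which contains \<open>v\<close> itself. Since the conclusion is again positivity at
  \<open>v\<close>, the lemma can be iterated over several coordinates.\<close>

lemma coord_int_pos:
  assumes "continuous_on UNIV f" "\<And>v. v \<in> cube \<Longrightarrow> 0 \<le> f v" "v \<in> cube" "0 < f v"
  shows "0 < coord_int i f v"
proof (rule ccontr)
  assume "\<not> 0 < coord_int i f v"
  then have "coord_int i f v = 0"
    using coord_int_nonneg[OF assms(1,2,3), of i] by linarith
  moreover have "continuous_on (cbox 0 1) (\<lambda>s. f (v(i := s)))"
    by (intro continuous_on_compose_fun_upd assms continuous_intros)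
  moreover have "0 \<le> f (v(i := s))" if "s \<in> cbox 0 1" for s
    using that by (intro assms(2) cube_upd assms(3)) auto
  ultimately have "\<forall>s\<in>cbox 0 1. f (v(i := s)) = 0"
    using integral_cbox_eq_0_iff[of 0 1 "\<lambda>s. f (v(i := s))"] by (auto simp: coord_int_def)
  moreover have "v i \<in> cbox 0 1" using assms(3) by (auto simp: cube_def)
  ultimately have "f (v(i := v i)) = 0" by blast
  then show False using assms(4) by simp
qed

text \<open>The divergence theorem for a divergence-free field with no flux through the spatial
  faces: the fluxes through the two time faces must then agree.\<close>

lemma divergence_cube:
  fixes W g :: "nat \<Rightarrow> (nat \<Rightarrow> real) \<Rightarrow> real"
  assumes deriv: "\<And>i v s. ((\<lambda>s. W i (v(i := s))) has_real_derivative g i (v(i := s))) (at s)"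
    and cont: "\<And>i. continuous_on UNIV (g i)"
    and div: "\<And>v. v \<in> cube \<Longrightarrow> g 0 v + g 1 v + g 2 v + g 3 v = 0"
    and bdry: "\<And>i v. v \<in> cube \<Longrightarrow> i \<in> {1,2,3} \<Longrightarrow> v i \<in> {0,1} \<Longrightarrow> W i v = 0"
    and v: "v \<in> cube"
  shows "coord_int 1 (coord_int 2 (coord_int 3 (\<lambda>v. W 0 (v(0 := 1)) - W 0 (v(0 := 0))))) v = 0"
proof -
  let ?T = "\<lambda>f. coord_int 0 (coord_int 1 (coord_int 2 (coord_int 3 f)))"
  have c1: "continuous_on UNIV (coord_int i (g l))" for i l
    by (intro continuous_on_coord_int cont)
  have c2: "continuous_on UNIV (coord_int i (coord_int j (g l)))" for i j l
    by (intro continuous_on_coord_int c1)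
  have c3: "continuous_on UNIV (coord_int i (coord_int j (coord_int k (g l))))" for i j k l
    by (intro continuous_on_coord_int c2)
  note cm1 = coord_int_commute[OF cont]
    and cm2 = coord_int_commute[OF c1]
    and cm3 = coord_int_commute[OF c2]
  have z: "coord_int l (g l) u = 0" if "u \<in> cube" "l \<in> {1,2,3}" for l u
  proof -
    have "W l (u(l := 1)) = 0" "W l (u(l := 0)) = 0"
      by (rule bdry[OF cube_upd[OF that(1)] that(2)]; simp)+
    then show ?thesis by (simp only: coord_int_FTC[of "W l" l "g l", OF deriv] diff_0_right)
  qed
  have z': "coord_int i (coord_int j (coord_int k (coord_int l (g l)))) v = 0"
    if "l \<in> {1,2,3}" for i j k l
    by (rule coord_int_eq_0[OF coord_int_eq_0[OF coord_int_eq_0[OF z[OF _ that]]] v])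
  have 3: "?T (g 3) v = 0" by (intro z') simp
  \<comment> \<open>Fubini moves the integration over variable \<open>l\<close> innermost, where
    \<open>z\<close> applies; \<open>g 3\<close> already has this form.\<close>
  have "?T (g 2) = coord_int 0 (coord_int 1 (coord_int 3 (coord_int 2 (g 2))))"
    by (subst cm1[of 3 2]) (simp, rule refl)
  then have 2: "?T (g 2) v = 0" by (rule ssubst) (rule z', simp)
  have "?T (g 1) = coord_int 0 (coord_int 2 (coord_int 3 (coord_int 1 (g 1))))"
  proof -
    have "coord_int 1 (coord_int 2 (coord_int 3 (g 1))) = coord_int 2 (coord_int 1 (coord_int 3 (g 1)))"
      by (rule cm2) simp
    also have "coord_int 1 (coord_int 3 (g 1)) = coord_int 3 (coord_int 1 (g 1))"
      by (rule cm1) simp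
    finally show ?thesis by (rule arg_cong)
  qed
  then have 1: "?T (g 1) v = 0" by (rule ssubst) (rule z', simp)
  \<comment> \<open>Here the time integral is moved innermost and evaluated, which produces the
    difference of the two time faces.\<close>
  have "?T (g 0) = coord_int 1 (coord_int 0 (coord_int 2 (coord_int 3 (g 0))))"
    by (rule cm3) simp
  also have "coord_int 0 (coord_int 2 (coord_int 3 (g 0))) = coord_int 2 (coord_int 0 (coord_int 3 (g 0)))"
    by (rule cm2) simp
  also have "coord_int 0 (coord_int 3 (g 0)) = coord_int 3 (coord_int 0 (g 0))"
    by (rule cm1) simp
  also have "coord_int 0 (g 0) = (\<lambda>v. W 0 (v(0 := 1)) - W 0 (v(0 := 0)))"
    by (intro ext coord_int_FTC deriv)
  finally have 0: "?T (g 0) = coord_int 1 (coord_int 2 (coord_int 3 \<dots>))" .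
  have "?T (\<lambda>v. \<Sum>l<4. g l v) = (\<lambda>v. \<Sum>l<4. ?T (g l) v)"
    unfolding coord_int_sum[of "{..<4}" g 3, OF finite_lessThan cont]
      coord_int_sum[of "{..<4}" "\<lambda>l. coord_int 3 (g l)" 2, OF finite_lessThan c1]
      coord_int_sum[of "{..<4}" "\<lambda>l. coord_int 2 (coord_int 3 (g l))" 1, OF finite_lessThan c2]
      coord_int_sum[of "{..<4}" "\<lambda>l. coord_int 1 (coord_int 2 (coord_int 3 (g l)))" 0,
        OF finite_lessThan c3] ..
  then have "?T (\<lambda>v. \<Sum>l<4. g l v) v = (\<Sum>l<4. ?T (g l) v)"
    by (rule fun_cong)
  also have "\<dots> = ?T (g 0) v + ?T (g 1) v + ?T (g 2) v + ?T (g 3) v"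
    by (simp add: eval_nat_numeral)
  also have "\<dots> = ?T (g 0) v"
    unfolding 1 2 3 by simp
  finally have "?T (g 0) v = ?T (\<lambda>v. \<Sum>l<4. g l v) v" ..
  also have "\<dots> = 0"
  proof -
    have "(\<Sum>l<4. g l u) = 0" if "u \<in> cube" for u
      using div[OF that] by (simp add: eval_nat_numeral)
    then show ?thesis
      by (rule coord_int_eq_0[OF coord_int_eq_0[OF coord_int_eq_0[OF coord_int_eq_0]] v])
  qed
  finally show ?thesis unfolding 0 .
qed

section \<open>Invariance of the weighted Jacobian integral\<close>

text \<open>The determinant of the derivatives of \<open>p\<close>, \<open>q\<close>,
  \<open>r\<close> in the variables \<open>i\<close>, \<open>j\<close>, \<open>k\<close>, expanded
  along the row of \<open>p\<close>.\<close>

definition jac :: "texp \<Rightarrow> texp \<Rightarrow> texp \<Rightarrow> nat \<Rightarrow> nat \<Rightarrow> nat \<Rightarrow> texp" where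
  "jac p q r i j k =
    Add (Mult (pd i p) (Add (Mult (pd j q) (pd k r)) (Mult (Const (-1)) (Mult (pd k q) (pd j r)))))
   (Add (Mult (pd j p) (Add (Mult (pd k q) (pd i r)) (Mult (Const (-1)) (Mult (pd i q) (pd k r)))))
        (Mult (pd k p) (Add (Mult (pd i q) (pd j r)) (Mult (Const (-1)) (Mult (pd j q) (pd i r))))))"

text \<open>The signed maximal minors of the 3 by 4 Jacobian matrix, that is, the generalised cross
  product of the three gradients. As a vector field it represents the 3-form dQ0 dQ1 dQ2.\<close>

definition minor :: "(nat \<Rightarrow> texp) \<Rightarrow> nat \<Rightarrow> texp" where
  "minor Q i =
    (if i = 0 then jac (Q 0) (Q 1) (Q 2) 1 2 3
     else if i = 1 then Mult (Const (-1)) (jac (Q 0) (Q 1) (Q 2) 0 2 3)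
     else if i = 2 then jac (Q 0) (Q 1) (Q 2) 0 1 3
     else Mult (Const (-1)) (jac (Q 0) (Q 1) (Q 2) 0 1 2))"

text \<open>This is d(dQ0 dQ1 dQ2) = 0: the second derivatives cancel in pairs once mixed partials
  are identified.\<close>

lemma minor_divergence:
  "eval_texp (pd 0 (minor Q 0)) v + eval_texp (pd 1 (minor Q 1)) v +
   eval_texp (pd 2 (minor Q 2)) v + eval_texp (pd 3 (minor Q 3)) v = 0"
proof -
  note c = eval_pd_commute[of 1 0] eval_pd_commute[of 2 0] eval_pd_commute[of 3 0]
    eval_pd_commute[of 2 1] eval_pd_commute[of 3 1] eval_pd_commute[of 3 2]
  show ?thesis
    by (simp add: minor_def jac_def c[unfolded One_nat_def] algebra_simps)
qed

text \<open>The left side expands a 4 by 4 determinant in which the gradient of \<open>Q j\<close>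
  occurs as two rows.\<close>

lemma minor_orthogonal:
  assumes "j \<in> {0,1,2}"
  shows "eval_texp (pd 0 (Q j)) v * eval_texp (minor Q 0) v + eval_texp (pd 1 (Q j)) v * eval_texp (minor Q 1) v +
   eval_texp (pd 2 (Q j)) v * eval_texp (minor Q 2) v + eval_texp (pd 3 (Q j)) v * eval_texp (minor Q 3) v = 0"
  using assms by (auto simp: minor_def jac_def algebra_simps)

section \<open>A bump function near the north pole and the flux that it weights\<close>

definition sqpos :: "real \<Rightarrow> real" where
  "sqpos s = (max 0 s)\<^sup>2"

text \<open>Squaring the positive part smooths its kink to class C1, which is the regularity that
  \<open>divergence_cube\<close> asks of the bump.\<close>

lemma has_real_derivative_sqpos: "(sqpos has_real_derivative 2 * max 0 s) (at s)"
proof -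
  consider "s > 0" | "s < 0" | "s = 0" by linarith
  then show ?thesis
  proof cases
    case 1
    have "((\<lambda>s::real. s\<^sup>2) has_real_derivative 2 * max 0 s) (at s)"
      using 1 by (auto intro!: derivative_eq_intros)
    then show ?thesis
      by (rule has_field_derivative_transform_within_open[of _ _ _ "{0<..}"])
        (use 1 in \<open>auto simp: sqpos_def\<close>)
  next
    case 2
    have "((\<lambda>s::real. 0) has_real_derivative 2 * max 0 s) (at s)"
      using 2 by (auto intro!: derivative_eq_intros)
    then show ?thesis
      by (rule has_field_derivative_transform_within_open[of _ _ _ "{..<0}"])
        (use 2 in \<open>auto simp: sqpos_def\<close>)
  next
    case 3
    have "((\<lambda>h::real. max 0 h) \<longlongrightarrow> max 0 0) (at 0)"
      by (intro tendsto_intros)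
    moreover have "max 0 h = sqpos h / h" if "h \<noteq> 0" for h
      using that by (auto simp: sqpos_def max_def power2_eq_square)
    ultimately have "((\<lambda>h. sqpos h / h) \<longlongrightarrow> 0) (at 0)"
      by (auto elim!: Lim_transform_eventually simp: eventually_at_filter)
    then show ?thesis
      using 3 by (simp add: DERIV_def sqpos_def)
  qed
qed

text \<open>On the unit sphere of \<open>\<real>\<^sup>4\<close> the bump is supported near the north pole. Near the sphere
  it is locally independent of the last coordinate, so that the pulled-back 3-form
  \<open>bump dy\<^sub>0 dy\<^sub>1 dy\<^sub>2\<close> is closed.\<close>

definition bump :: "(nat \<Rightarrow> texp) \<Rightarrow> (nat \<Rightarrow> real) \<Rightarrow> real" where
  "bump Q v = sqpos (1/4 - ((eval_texp (Q 0) v)\<^sup>2 + (eval_texp (Q 1) v)\<^sup>2 + (eval_texp (Q 2) v)\<^sup>2)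
     - sqpos (1/2 - eval_texp (Q 3) v))"

definition bump_pd :: "(nat \<Rightarrow> texp) \<Rightarrow> nat \<Rightarrow> (nat \<Rightarrow> real) \<Rightarrow> real" where
  "bump_pd Q i v =
     2 * max 0 (1/4 - ((eval_texp (Q 0) v)\<^sup>2 + (eval_texp (Q 1) v)\<^sup>2 + (eval_texp (Q 2) v)\<^sup>2)
       - sqpos (1/2 - eval_texp (Q 3) v)) *
     (2 * max 0 (1/2 - eval_texp (Q 3) v) * eval_texp (pd i (Q 3)) v
      - 2 * (eval_texp (Q 0) v * eval_texp (pd i (Q 0)) v + eval_texp (Q 1) v * eval_texp (pd i (Q 1)) v
        + eval_texp (Q 2) v * eval_texp (pd i (Q 2)) v))"

lemma has_real_derivative_bump:
  "((\<lambda>s. bump Q (v(i := s))) has_real_derivative bump_pd Q i (v(i := s))) (at s)"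
  unfolding bump_def bump_pd_def
  by (rule derivative_eq_intros DERIV_chain2[OF has_real_derivative_sqpos]
      has_real_derivative_eval_texp refl)+ (simp add: algebra_simps)

lemma continuous_on_bump [continuous_intros]: "continuous_on A (bump Q)"
  unfolding bump_def[abs_def] sqpos_def by (intro continuous_intros)

lemma continuous_on_bump_pd [continuous_intros]: "continuous_on A (bump_pd Q i)"
  unfolding bump_pd_def[abs_def] sqpos_def by (intro continuous_intros)

lemma bump_nonneg: "0 \<le> bump Q v"
  by (simp add: bump_def sqpos_def)

lemma bump_eq_0:
  assumes "1/4 \<le> (eval_texp (Q 0) v)\<^sup>2 + (eval_texp (Q 1) v)\<^sup>2 + (eval_texp (Q 2) v)\<^sup>2"
  shows "bump Q v = 0"
proof -
  have "0 \<le> sqpos (1/2 - eval_texp (Q 3) v)" by (simp add: sqpos_def)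
  then show ?thesis using assms unfolding bump_def by (subst sqpos_def) simp
qed

text \<open>The inner \<open>sqpos\<close> is at least 1/4 there. This removes the neighbourhood of
  the south pole, which the first three coordinates alone cannot tell from the north pole.\<close>

lemma bump_eq_0':
  assumes "eval_texp (Q 3) v \<le> 0"
  shows "bump Q v = 0"
proof -
  have "(1/2)\<^sup>2 \<le> (max 0 (1/2 - eval_texp (Q 3) v))\<^sup>2"
    using assms by (intro power_mono) auto
  then have "1/4 \<le> sqpos (1/2 - eval_texp (Q 3) v)"
    by (simp add: sqpos_def power2_eq_square)
  moreover have "0 \<le> (eval_texp (Q 0) v)\<^sup>2 + (eval_texp (Q 1) v)\<^sup>2 + (eval_texp (Q 2) v)\<^sup>2"
    by simp
  ultimately have "max 0 (1/4 - ((eval_texp (Q 0) v)\<^sup>2 + (eval_texp (Q 1) v)\<^sup>2 + (eval_texp (Q 2) v)\<^sup>2)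
      - sqpos (1/2 - eval_texp (Q 3) v)) = 0" by linarith
  then show ?thesis unfolding bump_def by (subst sqpos_def) simp
qed

text \<open>The gradient of the bump is a combination of the gradients of \<open>Q 0\<close>,
  \<open>Q 1\<close>, \<open>Q 2\<close>, because the term with the gradient of \<open>Q 3\<close>
  has a zero factor. The hypothesis is a weak form of lying on the unit sphere, chosen to survive
  approximation.\<close>

lemma bump_pd_locally_horizontal:
  assumes "(eval_texp (Q 0) v)\<^sup>2 + (eval_texp (Q 1) v)\<^sup>2 + (eval_texp (Q 2) v)\<^sup>2 < 1/4 \<Longrightarrow>
    1/4 \<le> (eval_texp (Q 3) v)\<^sup>2"
  obtains m where "\<And>i. bump_pd Q i v = m * (eval_texp (Q 0) v * eval_texp (pd i (Q 0)) v
    + eval_texp (Q 1) v * eval_texp (pd i (Q 1)) v + eval_texp (Q 2) v * eval_texp (pd i (Q 2)) v)"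
proof -
  let ?u = "(eval_texp (Q 0) v)\<^sup>2 + (eval_texp (Q 1) v)\<^sup>2 + (eval_texp (Q 2) v)\<^sup>2"
  let ?y = "eval_texp (Q 3) v"
  let ?m = "max 0 (1/4 - ?u - sqpos (1/2 - ?y))"
  have pos: "0 \<le> sqpos (1/2 - ?y)" "0 \<le> ?u" by (simp_all add: sqpos_def)
  have "?m * max 0 (1/2 - ?y) = 0"
  proof (cases "?u < 1/4")
    case True
    then have "(1/2)\<^sup>2 \<le> ?y\<^sup>2" using assms by (simp add: power2_eq_square)
    then have "1/2 \<le> \<bar>?y\<bar>" using abs_le_square_iff[of "1/2" ?y] by simp
    then consider "1/2 \<le> ?y" | "?y \<le> -1/2" by linarith
    then show ?thesis
    proof cases
      case 2
      \<comment> \<open>Near the south pole the penalty is at least 1, more than the 1/4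
        available.\<close>
      then have "1\<^sup>2 \<le> (max 0 (1/2 - ?y))\<^sup>2" by (intro power_mono) auto
      then have "1 \<le> sqpos (1/2 - ?y)" by (simp add: sqpos_def)
      then have "?m = 0" using pos by linarith
      then show ?thesis by simp
    qed simp
  next
    case False
    then have "?m = 0" using pos by linarith
    then show ?thesis by simp
  qed
  then have "bump_pd Q i v = - 4 * ?m * (eval_texp (Q 0) v * eval_texp (pd i (Q 0)) v
    + eval_texp (Q 1) v * eval_texp (pd i (Q 1)) v + eval_texp (Q 2) v * eval_texp (pd i (Q 2)) v)" for i
    unfolding bump_pd_def by algebra
  then show thesis by (rule that)
qed

definition flux :: "(nat \<Rightarrow> texp) \<Rightarrow> nat \<Rightarrow> (nat \<Rightarrow> real) \<Rightarrow> real" where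
  "flux Q i v = bump Q v * eval_texp (minor Q i) v"

text \<open>The flux field is the pullback of a closed 3-form. The hypothesis \<open>near\<close>
  keeps the image where the form is closed, and \<open>bdry\<close> keeps the spatial faces off its
  support.\<close>

lemma flux_conservation:
  assumes near: "\<And>v. v \<in> cube \<Longrightarrow>
      (eval_texp (Q 0) v)\<^sup>2 + (eval_texp (Q 1) v)\<^sup>2 + (eval_texp (Q 2) v)\<^sup>2 < 1/4 \<Longrightarrow>
      1/4 \<le> (eval_texp (Q 3) v)\<^sup>2"
    and bdry: "\<And>i v. v \<in> cube \<Longrightarrow> i \<in> {1,2,3} \<Longrightarrow> v i \<in> {0,1} \<Longrightarrow>
      1/4 \<le> (eval_texp (Q 0) v)\<^sup>2 + (eval_texp (Q 1) v)\<^sup>2 + (eval_texp (Q 2) v)\<^sup>2"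
    and v: "v \<in> cube"
  shows "coord_int 1 (coord_int 2 (coord_int 3 (\<lambda>v. flux Q 0 (v(0 := 1)) - flux Q 0 (v(0 := 0))))) v = 0"
proof (rule divergence_cube[where W = "flux Q" and
      g = "\<lambda>i v. bump_pd Q i v * eval_texp (minor Q i) v + bump Q v * eval_texp (pd i (minor Q i)) v"])
  show "((\<lambda>s. flux Q i (v(i := s))) has_real_derivative
      bump_pd Q i (v(i := s)) * eval_texp (minor Q i) (v(i := s)) +
      bump Q (v(i := s)) * eval_texp (pd i (minor Q i)) (v(i := s))) (at s)" for i v s
    unfolding flux_def
    by (rule derivative_eq_intros has_real_derivative_bump has_real_derivative_eval_texp)+
      (simp add: algebra_simps)
  show "continuous_on UNIV (\<lambda>v. bump_pd Q i v * eval_texp (minor Q i) v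
      + bump Q v * eval_texp (pd i (minor Q i)) v)" for i
    by (intro continuous_intros)
  show "flux Q i v = 0" if "v \<in> cube" "i \<in> {1,2,3}" "v i \<in> {0,1}" for i v
    using bump_eq_0[OF bdry[OF that]] by (simp add: flux_def)
  fix v assume "v \<in> cube"
  \<comment> \<open>By the product rule the divergence has two parts: the gradient of the bump is
    orthogonal to the minors, and the minors are divergence-free.\<close>
  obtain m where m: "\<And>i. bump_pd Q i v = m * (eval_texp (Q 0) v * eval_texp (pd i (Q 0)) v
    + eval_texp (Q 1) v * eval_texp (pd i (Q 1)) v + eval_texp (Q 2) v * eval_texp (pd i (Q 2)) v)"
    using bump_pd_locally_horizontal[of Q v, OF near[OF \<open>v \<in> cube\<close>]] by blast
  show "bump_pd Q 0 v * eval_texp (minor Q 0) v + bump Q v * eval_texp (pd 0 (minor Q 0)) v +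
     (bump_pd Q 1 v * eval_texp (minor Q 1) v + bump Q v * eval_texp (pd 1 (minor Q 1)) v) +
     (bump_pd Q 2 v * eval_texp (minor Q 2) v + bump Q v * eval_texp (pd 2 (minor Q 2)) v) +
     (bump_pd Q 3 v * eval_texp (minor Q 3) v + bump Q v * eval_texp (pd 3 (minor Q 3)) v) = 0"
    using minor_divergence[of Q v] minor_orthogonal[of 0 Q v] minor_orthogonal[of 1 Q v]
      minor_orthogonal[of 2 Q v]
    unfolding m by (simp del: One_nat_def) algebra
qed (rule v)

section \<open>Maps of the cube into the 3-sphere\<close>

lemma texp_approximation:
  fixes G :: "real \<times> real \<times> real \<times> real \<Rightarrow> real"
  assumes "continuous_on ({0..1} \<times> {0..1} \<times> {0..1} \<times> {0..1}) G" "0 < \<epsilon>"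
  obtains p where "\<And>v. v \<in> cube \<Longrightarrow> \<bar>G (v 0, v 1, v 2, v 3) - eval_texp p v\<bar> < \<epsilon>"
proof -
  have "compact ({0..1::real} \<times> {0..1::real} \<times> {0..1::real} \<times> {0..1::real})"
    by (intro compact_Times compact_Icc)
  then obtain g where g: "real_polynomial_function g"
    "\<And>x. x \<in> {0..1} \<times> {0..1} \<times> {0..1} \<times> {0..1} \<Longrightarrow> \<bar>G x - g x\<bar> < \<epsilon>"
    using Stone_Weierstrass_real_polynomial_function[OF _ assms] by metis
  obtain p where p: "\<forall>v. eval_texp p v = g (v 0, v 1, v 2, v 3)"
    using real_polynomial_function_texp[OF g(1)] by blast
  show thesis
  proof (rule that)
    fix v :: "nat \<Rightarrow> real" assume "v \<in> cube"
    then have "(v 0, v 1, v 2, v 3) \<in> {0..1} \<times> {0..1} \<times> {0..1} \<times> {0..1}"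
      by (simp add: cube_def)
    from g(2)[OF this] show "\<bar>G (v 0, v 1, v 2, v 3) - eval_texp p v\<bar> < \<epsilon>"
      using p by simp
  qed
qed

text \<open>Follows from y^2 - x^2 = 2y(y - x) - (y - x)^2.\<close>

lemma square_perturbation:
  fixes x y \<delta> :: real
  assumes "\<bar>x - y\<bar> \<le> \<delta>" "\<bar>y\<bar> \<le> 1"
  shows "y\<^sup>2 - 2 * \<delta> \<le> x\<^sup>2"
proof -
  have "y\<^sup>2 - x\<^sup>2 \<le> 2 * (y * (y - x))"
    using zero_le_power2[of "y - x"] by (simp add: power2_eq_square algebra_simps)
  also have "y * (y - x) \<le> \<bar>y\<bar> * \<bar>y - x\<bar>"
    by (metis abs_ge_self abs_mult)
  also have "\<dots> \<le> 1 * \<delta>"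
    using assms by (intro mult_mono) auto
  finally show ?thesis by simp
qed

text \<open>The weighted Jacobian integral is the same at both ends of the homotopy. It is zero for
  the constant map, while \<open>nonneg\<close> and the point \<open>u\<close> make it positive for
  \<open>E\<close>. As \<open>F\<close> is merely continuous, the flux argument is run on an
  approximation that agrees exactly with \<open>E\<close> and \<open>c\<close> at the ends.\<close>

theorem no_nullhomotopy_of_positive_map:
  fixes F :: "nat \<Rightarrow> real \<times> real \<times> real \<times> real \<Rightarrow> real"
  assumes cont: "\<And>j. continuous_on ({0..1} \<times> {0..1} \<times> {0..1} \<times> {0..1}) (F j)"
    and sphere: "\<And>v. v \<in> cube \<Longrightarrow> (F 0 (v 0, v 1, v 2, v 3))\<^sup>2 + (F 1 (v 0, v 1, v 2, v 3))\<^sup>2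
        + (F 2 (v 0, v 1, v 2, v 3))\<^sup>2 + (F 3 (v 0, v 1, v 2, v 3))\<^sup>2 = 1"
    and bdry: "\<And>i v. v \<in> cube \<Longrightarrow> i \<in> {1,2,3} \<Longrightarrow> v i \<in> {0,1} \<Longrightarrow> F 3 (v 0, v 1, v 2, v 3) = 0"
    and start: "\<And>j v. v \<in> cube \<Longrightarrow> j < 4 \<Longrightarrow> F j (0, v 1, v 2, v 3) = eval_texp (E j) v"
    and final: "\<And>j v. v \<in> cube \<Longrightarrow> j < 4 \<Longrightarrow> F j (1, v 1, v 2, v 3) = c j"
    and nonneg: "\<And>v. v \<in> cube \<Longrightarrow> 0 < eval_texp (E 3) v \<Longrightarrow>
        0 \<le> eval_texp (jac (E 0) (E 1) (E 2) 1 2 3) v"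
    and u: "u \<in> cube" "u 0 = 0" "eval_texp (E 0) u = 0" "eval_texp (E 1) u = 0"
        "eval_texp (E 2) u = 0" "eval_texp (E 3) u = 1"
        "0 < eval_texp (jac (E 0) (E 1) (E 2) 1 2 3) u"
  shows False
proof -
  have "\<forall>j. \<exists>p. \<forall>v\<in>cube. \<bar>F j (v 0, v 1, v 2, v 3) - eval_texp p v\<bar> < 1/40"
    using texp_approximation[OF cont, of "1/40"] by (metis divide_pos_pos zero_less_numeral zero_less_one)
  then obtain P where P: "\<And>j v. v \<in> cube \<Longrightarrow> \<bar>F j (v 0, v 1, v 2, v 3) - eval_texp (P j) v\<bar> < 1/40"
    by metis
  \<comment> \<open>The approximation errors at times 0 and 1 are interpolated linearly in time and
    removed, so both ends become exact. The total error is at most 1/40 + (1 - t)/40 + t/40 = 1/20,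
    and squares drop by at most 1/10.\<close>
  define Q where "Q j = Add (P j) (Add
      (Mult (Add (Const 1) (Mult (Const (-1)) (Var 0)))
        (Add (fix_time 0 (E j)) (Mult (Const (-1)) (fix_time 0 (P j)))))
      (Mult (Var 0) (Add (Const (c j)) (Mult (Const (-1)) (fix_time 1 (P j))))))" for j
  have Q0: "eval_texp (Q j) (v(0 := 0)) = eval_texp (E j) (v(0 := 0))" for j v
    by (simp add: Q_def)
  have Q1: "eval_texp (Q j) (v(0 := 1)) = eval_texp (Const (c j)) (v(0 := 1))" for j v
    by (simp add: Q_def)
  have close: "\<bar>eval_texp (Q j) v - F j (v 0, v 1, v 2, v 3)\<bar> \<le> 1/20"
    if v: "v \<in> cube" and j: "j < 4" for j v
  proof -
    let ?t = "v 0"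
    let ?a = "eval_texp (P j) v - F j (v 0, v 1, v 2, v 3)"
    let ?b = "F j (0, v 1, v 2, v 3) - eval_texp (P j) (v(0 := 0))"
    let ?d = "F j (1, v 1, v 2, v 3) - eval_texp (P j) (v(0 := 1))"
    have t: "0 \<le> ?t" "?t \<le> 1" using v by (auto simp: cube_def)
    have v01: "v(0 := 0) \<in> cube" "v(0 := 1) \<in> cube" by (rule cube_upd[OF v]; simp)+
    have a: "\<bar>?a\<bar> \<le> 1/40" using P[OF v, of j] by linarith
    have b: "\<bar>?b\<bar> \<le> 1/40" using P[OF v01(1), of j] by simp
    have d: "\<bar>?d\<bar> \<le> 1/40" using P[OF v01(2), of j] by simp
    have "eval_texp (Q j) v - F j (v 0, v 1, v 2, v 3) = ?a + ((1 - ?t) * ?b + ?t * ?d)"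
      using start[OF v01(1) j] final[OF v j] by (simp add: Q_def)
    moreover have "\<bar>(1 - ?t) * ?b\<bar> \<le> (1 - ?t) * (1/40)"
      unfolding abs_mult using t b by (intro mult_mono) auto
    moreover have "\<bar>?t * ?d\<bar> \<le> ?t * (1/40)"
      unfolding abs_mult using t d by (intro mult_mono) auto
    moreover have "\<bar>x + (y + z)\<bar> \<le> 1/20"
      if "\<bar>x\<bar> \<le> 1/40" "\<bar>y\<bar> \<le> (1 - ?t) * (1/40)" "\<bar>z\<bar> \<le> ?t * (1/40)" for x y z
      using abs_triangle_ineq[of x "y + z"] abs_triangle_ineq[of y z] that
      by (simp add: left_diff_distrib)
    ultimately show ?thesis using a by metis
  qed
  have lower: "(F j (v 0, v 1, v 2, v 3))\<^sup>2 - 1/10 \<le> (eval_texp (Q j) v)\<^sup>2"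
    if v: "v \<in> cube" and j: "j < 4" for j v
  proof -
    have "j = 0 \<or> j = 1 \<or> j = 2 \<or> j = 3" using j by linarith
    then have "(F j (v 0, v 1, v 2, v 3))\<^sup>2 \<le> 1\<^sup>2"
      using sphere[OF v] zero_le_power2[of "F 0 (v 0, v 1, v 2, v 3)"]
        zero_le_power2[of "F 1 (v 0, v 1, v 2, v 3)"] zero_le_power2[of "F 2 (v 0, v 1, v 2, v 3)"]
        zero_le_power2[of "F 3 (v 0, v 1, v 2, v 3)"]
      by (elim disjE; simp only: one_power2; linarith)
    then have "\<bar>F j (v 0, v 1, v 2, v 3)\<bar> \<le> 1" by (simp add: abs_square_le_1)
    from square_perturbation[OF close[OF v j] this] show ?thesis by simp
  qed
  have lower4: "(F 0 (v 0, v 1, v 2, v 3))\<^sup>2 - 1/10 \<le> (eval_texp (Q 0) v)\<^sup>2"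
    "(F 1 (v 0, v 1, v 2, v 3))\<^sup>2 - 1/10 \<le> (eval_texp (Q 1) v)\<^sup>2"
    "(F 2 (v 0, v 1, v 2, v 3))\<^sup>2 - 1/10 \<le> (eval_texp (Q 2) v)\<^sup>2"
    "(F 3 (v 0, v 1, v 2, v 3))\<^sup>2 - 1/10 \<le> (eval_texp (Q 3) v)\<^sup>2" if "v \<in> cube" for v
    by (rule lower[OF that]; simp)+
  have total: "coord_int 1 (coord_int 2 (coord_int 3
      (\<lambda>v. flux Q 0 (v(0 := 1)) - flux Q 0 (v(0 := 0))))) u = 0"
  proof (rule flux_conservation[OF _ _ u(1)])
    \<comment> \<open>If the first three squares of \<open>Q\<close> sum to less than 1/4, those of
      \<open>F\<close> sum to less than 11/20; so the square of \<open>F 3\<close> exceeds 9/20 and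
      that of \<open>Q 3\<close> exceeds 7/20.\<close>
    show "1/4 \<le> (eval_texp (Q 3) v)\<^sup>2"
      if "v \<in> cube" "(eval_texp (Q 0) v)\<^sup>2 + (eval_texp (Q 1) v)\<^sup>2 + (eval_texp (Q 2) v)\<^sup>2 < 1/4" for v
      using lower4[OF that(1)] sphere[OF that(1)] that(2) by linarith
    \<comment> \<open>On a spatial face the first three squares of \<open>F\<close> sum to 1, so
      those of \<open>Q\<close> sum to at least 7/10.\<close>
    show "1/4 \<le> (eval_texp (Q 0) v)\<^sup>2 + (eval_texp (Q 1) v)\<^sup>2 + (eval_texp (Q 2) v)\<^sup>2"
      if "v \<in> cube" "i \<in> {1,2,3}" "v i \<in> {0,1}" for i v
    proof -
      have "(F 3 (v 0, v 1, v 2, v 3))\<^sup>2 = 0" using bdry[OF that] by simp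
      then show ?thesis using lower4[OF that(1)] sphere[OF that(1)] by linarith
    qed
  qed
  define f where "f v = bump E (v(0 := 0)) * eval_texp (jac (E 0) (E 1) (E 2) 1 2 3) (v(0 := 0))" for v
  have "eval_texp (pd i (Q j)) (v(0 := 0)) = eval_texp (pd i (E j)) (v(0 := 0))" if "i \<noteq> 0" for i j v
    using eval_pd_fixed_time_cong[of "Q j" 0 "E j"] Q0 that by blast
  then have "flux Q 0 (v(0 := 0)) = f v" for v
    by (simp add: flux_def minor_def jac_def f_def bump_def Q0)
  moreover have "eval_texp (pd i (Q j)) (v(0 := 1)) = 0" if "i \<noteq> 0" for i j v
    using eval_pd_fixed_time_cong[of "Q j" 1 "Const (c j)" i v] Q1 that by simp
  then have "flux Q 0 (v(0 := 1)) = 0" for v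
    by (simp add: flux_def minor_def jac_def)
  ultimately have "coord_int 1 (coord_int 2 (coord_int 3 (\<lambda>v. - f v))) u = 0"
    using total by simp
  moreover have "coord_int i (\<lambda>v. - g v) = (\<lambda>v. - coord_int i g v)" for i g
    by (simp add: coord_int_def[abs_def])
  ultimately have zero: "coord_int 1 (coord_int 2 (coord_int 3 f)) u = 0"
    by simp
  have cf: "continuous_on UNIV f"
    unfolding f_def[abs_def]
    by (rule continuous_on_compose_fun_upd[of "\<lambda>v. bump E v * eval_texp (jac (E 0) (E 1) (E 2) 1 2 3) v"])
      (intro continuous_intros)+
  \<comment> \<open>The sign of the Jacobian is known only over the upper hemisphere; elsewhere the
    bump vanishes.\<close>
  have f_nonneg: "0 \<le> f v" if "v \<in> cube" for v
  proof (cases "0 < eval_texp (E 3) (v(0 := 0))")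
    case True
    have "v(0 := 0) \<in> cube" by (rule cube_upd[OF that]) simp
    from nonneg[OF this True] show ?thesis by (simp add: f_def bump_nonneg)
  next
    case False
    then show ?thesis using bump_eq_0'[of E "v(0 := 0)"] by (simp add: f_def)
  qed
  have "u(0 := 0) = u" using u(2) by auto
  \<comment> \<open>The point \<open>u\<close> is sent to the north pole, where the bump has its
    value 1/16.\<close>
  then have f_pos: "0 < f u"
    using u by (simp add: f_def bump_def sqpos_def)
  have "0 < coord_int 1 (coord_int 2 (coord_int 3 f)) u"
    by (intro coord_int_pos coord_int_nonneg continuous_on_coord_int cf f_nonneg f_pos u(1))
  then show False using zero by simp
qed

section \<open>Equivariant maps on a cross-section\<close>

text \<open>The unit quaternion ai + bj fixes (p, w) under conjugation, so by equivariance it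
  commutes with the image. Its centraliser is spanned by 1 and itself, and contains no
  \<open>k\<close>-component.\<close>

lemma equivariant_qim3_eq_0:
  assumes "SO3_equivariant f" "(p, w) \<in> S6" "a\<^sup>2 + b\<^sup>2 = 1"
    and "Quat 0 a b 0 * p = p * Quat 0 a b 0" "Quat 0 a b 0 * w = w * Quat 0 a b 0"
  shows "qim3 (f (p, w)) = 0"
proof -
  let ?u = "Quat 0 a b 0" and ?y = "f (p, w)"
  have n: "norm ?u = 1" using assms(3) by (simp add: norm_quat_def)
  have u: "?u * qcnj ?u = 1" "qcnj ?u * ?u = 1" by (simp_all add: qcnj_mult_self n)
  have "?u \<in> S3" using n by simp
  then have "f (?u * p * qcnj ?u, ?u * w * qcnj ?u) = ?u * ?y * qcnj ?u"
    using assms(1,2) unfolding SO3_equivariant_def by blast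
  moreover have "?u * p * qcnj ?u = p" "?u * w * qcnj ?u = w"
    using u(1) by (simp_all add: assms(4,5) mult.assoc)
  ultimately have "?y = ?u * ?y * qcnj ?u" by simp
  then have "?y * ?u = ?u * ?y * qcnj ?u * ?u" by (rule arg_cong)
  then have "?y * ?u = ?u * ?y" by (simp only: mult.assoc u(2) mult_1_right)
  then have "a * qim3 ?y = 0" "b * qim3 ?y = 0"
    by (simp_all add: quat_eq_iff)
  then show ?thesis using assms(3) by auto
qed

lemma de_Moivre_imaginary_unit:
  fixes u :: "'a::real_algebra_1"
  assumes "u * u = -1"
  shows "(of_real (cos t) + sin t *\<^sub>R u) ^ n = of_real (cos (real n * t)) + sin (real n * t) *\<^sub>R u"
proof (induction n)
  case (Suc n)
  have "(of_real a + b *\<^sub>R u) * (of_real c + d *\<^sub>R u) = of_real (a * c - b * d) + (a * d + b * c) *\<^sub>R u"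
    for a b c d
    by (simp add: of_real_def algebra_simps assms)
  then show ?case
    by (simp add: Suc.IH cos_add sin_add algebra_simps)
qed simp

section \<open>A cross-section of the orbits in \<open>S6\<close> and the Blakers-Massey map on
  it\<close>

definition section_direction :: "real \<Rightarrow> real \<Rightarrow> quat" where
  "section_direction s r = Quat (cos (pi * s)) (sin (pi * s) * cos (pi * r)) (sin (pi * s) * sin (pi * r)) 0"

text \<open>For parameters in the unit cube, \<open>section_direction\<close> runs through spherical
  coordinates on the unit half-sphere x + yi + zj with z >= 0. Every orbit is met: rotate p onto the
  nonnegative i-axis, then rotate about that axis until the j,k-part of w is a nonnegative multiple
  of j.\<close>

definition cross_section :: "real \<times> real \<times> real \<Rightarrow> quat \<times> quat" where
  "cross_section = (\<lambda>(a, s, r). (Quat 0 a 0 0, sqrt (1 - a\<^sup>2) *\<^sub>R section_direction s r))"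

lemma norm_section_direction [simp]: "norm (section_direction s r) = 1"
proof -
  have "(cos (pi * s))\<^sup>2 + (sin (pi * s) * cos (pi * r))\<^sup>2 + (sin (pi * s) * sin (pi * r))\<^sup>2 = 1"
    using sin_cos_squared_add[of "pi * s"] sin_cos_squared_add[of "pi * r"] by algebra
  then show ?thesis by (simp add: norm_quat_def section_direction_def)
qed

lemma cross_section_in_S6: "a \<in> {0..1} \<Longrightarrow> cross_section (a, s, r) \<in> S6"
  by (simp add: cross_section_def S6_def power_mult_distrib abs_square_le_1)
     (simp add: norm_quat_def)

lemma continuous_on_Quat [continuous_intros]:
  assumes "continuous_on A f" "continuous_on A g" "continuous_on A h" "continuous_on A k"
  shows "continuous_on A (\<lambda>x. Quat (f x) (g x) (h x) (k x))"
proof -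
  have "(\<lambda>x. Quat (f x) (g x) (h x) (k x)) =
    (\<lambda>x. f x *\<^sub>R 1 + g x *\<^sub>R Quat 0 1 0 0 + h x *\<^sub>R Quat 0 0 1 0 + k x *\<^sub>R Quat 0 0 0 1)"
    by (rule ext) (simp add: quat_eq_iff)
  then show ?thesis by (simp only:) (intro continuous_intros assms)
qed

lemma continuous_on_cross_section: "continuous_on A cross_section"
  unfolding cross_section_def section_direction_def split_beta
  by (intro continuous_intros)

text \<open>With H = x + yi + zj, conjugating cos(pi a) + sin(pi a) i by H replaces i by the
  imaginary unit H i H*, where H* is the conjugate of H. This is the Hopf map, and de Moivre then
  multiplies the angle by 12.\<close>

lemma blakers_massey_power_cross_section:
  fixes a s r :: real
  assumes "a \<in> {0..1}"
  defines "x \<equiv> cos (pi * s)" and "y \<equiv> sin (pi * s) * cos (pi * r)" and "z \<equiv> sin (pi * s) * sin (pi * r)"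
  shows "blakers_massey (cross_section (a, s, r)) ^ 12 =
    Quat (cos (12 * pi * a)) (sin (12 * pi * a) * (1 - 2 * (z * z)))
      (sin (12 * pi * a) * (2 * (z * y))) (sin (12 * pi * a) * (- 2 * (z * x)))"
proof (cases "a = 1")
  case True
  \<comment> \<open>At a = 1 the component w is 0, so the map takes its separate value -1, whose
    twelfth power matches the formula at angle 12 pi.\<close>
  have "cos (12 * pi) = 1" "sin (12 * pi) = 0"
    using cos_2npi[of 6] sin_2npi[of 6] by simp_all
  then show ?thesis
    using True by (simp add: blakers_massey_def cross_section_def quat_eq_iff)
next
  case False
  let ?H = "section_direction s r"
  let ?c = "sqrt (1 - a\<^sup>2)"
  let ?u = "Quat 0 (1 - 2 * (z * z)) (2 * (z * y)) (- 2 * (z * x))"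
  have a: "0 \<le> a" "a < 1" using assms(1) False by auto
  then have c: "0 < ?c" by (simp add: power_less_one_iff abs_square_less_1)
  have H: "?H = Quat x y z 0" by (simp add: section_direction_def x_def y_def z_def)
  have xyz: "x\<^sup>2 + y\<^sup>2 + z\<^sup>2 = 1"
    using norm_section_direction[of s r] by (simp add: H norm_quat_def)
  have "?H \<noteq> 0" using norm_section_direction[of s r] by (metis norm_zero zero_neq_one)
  have n: "norm (?c *\<^sub>R ?H) = ?c" using c by simp
  have e: "exp_im (pi *\<^sub>R Quat 0 a 0 0) = Quat (cos (pi * a)) (sin (pi * a)) 0 0"
  proof -
    have "norm (pi *\<^sub>R Quat 0 a 0 0) = pi * a" using a by (simp add: norm_quat_def)
    then show ?thesis
      using a by (cases "a = 0") (simp_all add: exp_im_def norm_quat_def quat_eq_iff of_real_def field_simps)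
  qed
  have q: "qcnj (?c *\<^sub>R ?H) /\<^sub>R ?c = qcnj ?H"
    using c by (simp add: qcnj_def quat_eq_iff)
  have "blakers_massey (cross_section (a, s, r)) = ?H * Quat (cos (pi * a)) (sin (pi * a)) 0 0 * qcnj ?H"
    using c \<open>?H \<noteq> 0\<close> by (simp add: blakers_massey_def cross_section_def n e q del: norm_scaleR)
  also have "\<dots> = of_real (cos (pi * a)) + sin (pi * a) *\<^sub>R ?u"
    using xyz unfolding quat_eq_iff H
    by (simp add: qcnj_def of_real_def) algebra
  finally have "blakers_massey (cross_section (a, s, r)) ^ 12 =
      (of_real (cos (pi * a)) + sin (pi * a) *\<^sub>R ?u) ^ 12" by simp
  also have "?u * ?u = - 1"
    using xyz unfolding quat_eq_iff by simp algebra
  from de_Moivre_imaginary_unit[OF this, of "pi * a" 12]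
  have "(of_real (cos (pi * a)) + sin (pi * a) *\<^sub>R ?u) ^ 12 =
    of_real (cos (12 * pi * a)) + sin (12 * pi * a) *\<^sub>R ?u" by (simp add: mult.assoc)
  also have "\<dots> = Quat (cos (12 * pi * a)) (sin (12 * pi * a) * (1 - 2 * (z * z)))
      (sin (12 * pi * a) * (2 * (z * y))) (sin (12 * pi * a) * (- 2 * (z * x)))"
    by (simp add: quat_eq_iff of_real_def)
  finally show ?thesis .
qed

text \<open>Each boundary point is fixed by a rotation about an axis in the i,j-plane. If a = 0,
  then p = 0 and the axis is the imaginary part of w, when that is nonzero.\<close>

lemma equivariant_qim3_cross_section_boundary:
  assumes "SO3_equivariant f" "a \<in> {0..1}" "a \<in> {0,1} \<or> s \<in> {0,1} \<or> r \<in> {0,1}"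
  shows "qim3 (f (cross_section (a, s, r))) = 0"
proof -
  define y where "y = sin (pi * s) * cos (pi * r)"
  define z where "z = sin (pi * s) * sin (pi * r)"
  obtain p w where pw: "cross_section (a, s, r) = (p, w)" by fastforce
  have p: "p = Quat 0 a 0 0" and w: "w = sqrt (1 - a\<^sup>2) *\<^sub>R Quat (cos (pi * s)) y z 0"
    using pw by (simp_all add: cross_section_def section_direction_def y_def z_def)
  have S6: "(p, w) \<in> S6" using cross_section_in_S6[OF assms(2)] pw by metis
  show ?thesis
  proof (cases "a = 0 \<and> (y, z) \<noteq> (0, 0)")
    case True
    let ?n = "sqrt (y\<^sup>2 + z\<^sup>2)"
    have pos: "0 < y\<^sup>2 + z\<^sup>2" using True by (auto simp: sum_power2_gt_zero_iff)
    have "(y / ?n)\<^sup>2 + (z / ?n)\<^sup>2 = (y\<^sup>2 + z\<^sup>2) / (y\<^sup>2 + z\<^sup>2)"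
      by (simp only: power_divide add_divide_distrib real_sqrt_pow2 sum_power2_ge_zero)
    also have "\<dots> = 1" using pos by (intro divide_self) linarith
    finally have unit: "(y / ?n)\<^sup>2 + (z / ?n)\<^sup>2 = 1" .
    show ?thesis
      unfolding pw
      by (rule equivariant_qim3_eq_0[OF assms(1) S6 unit]) (use True in \<open>simp_all add: p w quat_eq_iff\<close>)
  next
    case False
    \<comment> \<open>In the remaining cases w is 0 or lies in the span of 1 and i, as p does, so
      the axis i works.\<close>
    have "a = 1 \<or> z = 0"
      using assms(3) False by (auto simp: z_def)
    then have "Quat 0 1 0 0 * w = w * Quat 0 1 0 0"
      by (auto simp: w quat_eq_iff)
    moreover have "Quat 0 1 0 0 * p = p * Quat 0 1 0 0"
      by (simp add: p quat_eq_iff)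
    ultimately show ?thesis
      using equivariant_qim3_eq_0[OF assms(1) S6, of 1 0] unfolding pw by simp
  qed
qed

text \<open>Transcribes the formula of \<open>blakers_massey_power_cross_section\<close>, with
  variables 1, 2, 3 in the roles of a, s, r.\<close>

definition bm_power_texp :: "nat \<Rightarrow> texp" where
  "bm_power_texp j =
    (let \<theta> = Mult (Const (12 * pi)) (Var 1); S = Mult (Const pi) (Var 2); R = Mult (Const pi) (Var 3);
         x = Cos S; y = Mult (Sin S) (Cos R); z = Mult (Sin S) (Sin R)
     in if j = 0 then Cos \<theta>
        else if j = 1 then Mult (Sin \<theta>) (Add (Const 1) (Mult (Const (- 2)) (Mult z z)))
        else if j = 2 then Mult (Sin \<theta>) (Mult (Const 2) (Mult z y))
        else Mult (Sin \<theta>) (Mult (Const (- 2)) (Mult z x)))"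

text \<open>The Jacobian is a nonnegative multiple of the last component: all preimages of the
  north pole count with the same sign.\<close>

lemma jac_bm_power_texp:
  "eval_texp (jac (bm_power_texp 0) (bm_power_texp 1) (bm_power_texp 2) 1 2 3) v =
    48 * pi ^ 3 * (sin (12 * pi * v 1))\<^sup>2 * eval_texp (bm_power_texp 3) v
      * (sin (pi * v 2))\<^sup>2 * sin (pi * v 3)"
proof -
  have "(sin (pi * v 3))\<^sup>2 + (cos (pi * v 3))\<^sup>2 = 1" by simp
  then show ?thesis
    by (simp only: jac_def bm_power_texp_def Let_def eval_texp.simps pd.simps if_True if_False
        one_neq_zero zero_neq_one zero_neq_numeral numeral_neq_zero one_eq_numeral_iff numeral_eq_one_iff
        numeral_eq_iff num.distinct num.inject simp_thms) algebra
qed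

theorem theorem4p1:
  "\<not> (\<exists>(\<phi> :: real \<times> (quat \<times> quat) \<Rightarrow> quat) c.
        differentiable_homotopy S6 S3 (\<lambda>x. blakers_massey x ^ 12) (\<lambda>x. c) \<phi> \<and>
        (\<forall>t\<in>{0..1}. SO3_equivariant (\<lambda>x. \<phi> (t, x))))"
proof
  assume "\<exists>(\<phi> :: real \<times> (quat \<times> quat) \<Rightarrow> quat) c.
        differentiable_homotopy S6 S3 (\<lambda>x. blakers_massey x ^ 12) (\<lambda>x. c) \<phi> \<and>
        (\<forall>t\<in>{0..1}. SO3_equivariant (\<lambda>x. \<phi> (t, x)))"
  then obtain \<phi> c where
    hom: "differentiable_homotopy S6 S3 (\<lambda>x. blakers_massey x ^ 12) (\<lambda>x. c) \<phi>"
    and eqv: "\<And>t. t \<in> {0..1} \<Longrightarrow> SO3_equivariant (\<lambda>x. \<phi> (t, x))" by blast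
  have cont: "continuous_on ({0..1} \<times> S6) \<phi>"
    and into: "\<And>t x. t \<in> {0..1} \<Longrightarrow> x \<in> S6 \<Longrightarrow> norm (\<phi> (t, x)) = 1"
    and start: "\<And>x. x \<in> S6 \<Longrightarrow> \<phi> (0, x) = blakers_massey x ^ 12"
    and final: "\<And>x. x \<in> S6 \<Longrightarrow> \<phi> (1, x) = c"
    using hom unfolding differentiable_homotopy_def by (auto intro: differentiable_imp_continuous_on)
  define B where "B j = (if j = 0 then 1 else if j = 1 then Quat 0 1 0 0
    else if j = 2 then Quat 0 0 1 0 else Quat 0 0 0 1)" for j :: nat
  have B: "B 0 \<bullet> q = qre q" "B 1 \<bullet> q = qim1 q" "B 2 \<bullet> q = qim2 q" "B 3 \<bullet> q = qim3 q" for q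
    by (simp_all add: B_def inner_quat_def)
  define F where "F j = (\<lambda>(t, x). B j \<bullet> \<phi> (t, cross_section x))" for j
  \<comment> \<open>A preimage of the north pole \<open>k\<close>: a = 1/24 makes the angle pi/2,
    while s = 3/4 and r = 1/2 give y = 0 and z = -x = \<open>sqrt 2 / 2\<close>, hence -2zx =
    1.\<close>
  define u :: "nat \<Rightarrow> real" where "u = (\<lambda>i. if i = 1 then 1/24 else if i = 2 then 3/4 else if i = 3 then 1/2 else 0)"
  have S6: "cross_section (v 1, v 2, v 3) \<in> S6" if "v \<in> cube" for v
    using that by (intro cross_section_in_S6) (simp add: cube_def)
  have S: "(sqrt 2 / 2)\<^sup>2 = 1/2" by (simp add: power_divide)
  have "pi * 3 / 4 = pi - pi/4" by simp
  then have sin34: "sin (pi * 3 / 4) = sqrt 2 / 2" and cos34: "cos (pi * 3 / 4) = - (sqrt 2 / 2)"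
    by (simp_all only: sin_pi_minus cos_pi_minus sin_45 cos_45)
  have u3: "eval_texp (bm_power_texp 3) u = 1"
    using S by (simp add: bm_power_texp_def Let_def u_def sin34 cos34 power2_eq_square)
  show False
  proof (rule no_nullhomotopy_of_positive_map[where F = F and E = bm_power_texp and c = "\<lambda>j. B j \<bullet> c" and u = u])
    show "continuous_on ({0..1} \<times> {0..1} \<times> {0..1} \<times> {0..1}) (F j)" for j
    proof -
      have "continuous_on ({0..1} \<times> {0..1} \<times> {0..1} \<times> {0..1}) (\<lambda>y. \<phi> (fst y, cross_section (snd y)))"
        by (rule continuous_on_compose2[OF cont])
          (auto intro!: continuous_intros continuous_on_compose2[OF continuous_on_cross_section[of UNIV]]
            cross_section_in_S6)
      then show ?thesis
        unfolding F_def split_beta by (intro continuous_intros)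
    qed
    show "(F 0 (v 0, v 1, v 2, v 3))\<^sup>2 + (F 1 (v 0, v 1, v 2, v 3))\<^sup>2
        + (F 2 (v 0, v 1, v 2, v 3))\<^sup>2 + (F 3 (v 0, v 1, v 2, v 3))\<^sup>2 = 1" if "v \<in> cube" for v
    proof -
      have "v 0 \<in> {0..1}" using that by (simp add: cube_def)
      from into[OF this S6[OF that]] show ?thesis by (simp add: F_def B[unfolded One_nat_def] norm_quat_def)
    qed
    show "F 3 (v 0, v 1, v 2, v 3) = 0" if "v \<in> cube" "i \<in> {1,2,3}" "v i \<in> {0,1}" for i v
    proof -
      have "v 0 \<in> {0..1}" "v 1 \<in> {0..1}" using that(1) by (simp_all add: cube_def)
      from equivariant_qim3_cross_section_boundary[OF eqv[OF this(1)] this(2), of "v 2" "v 3"] that(2,3)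
      show ?thesis by (auto simp: F_def B)
    qed
    show "F j (0, v 1, v 2, v 3) = eval_texp (bm_power_texp j) v" if "v \<in> cube" "j < 4" for j v
    proof -
      have "v 1 \<in> {0..1}" using that(1) by (simp add: cube_def)
      note b = blakers_massey_power_cross_section[OF this, of "v 2" "v 3"]
      have "j = 0 \<or> j = 1 \<or> j = 2 \<or> j = 3" using that(2) by linarith
      then show ?thesis
        using start[OF S6[OF that(1)]]
        by (elim disjE) (simp_all add: F_def B[unfolded One_nat_def] b[unfolded One_nat_def] bm_power_texp_def Let_def)
    qed
    show "F j (1, v 1, v 2, v 3) = B j \<bullet> c" if "v \<in> cube" for j v
      using final[OF S6[OF that]] by (simp add: F_def)
    show "0 \<le> eval_texp (jac (bm_power_texp 0) (bm_power_texp 1) (bm_power_texp 2) 1 2 3) v"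
      if "v \<in> cube" "0 < eval_texp (bm_power_texp 3) v" for v
    proof -
      have "0 \<le> sin (pi * v 3)"
        using that(1) by (intro sin_ge_zero) (simp_all add: cube_def mult_left_le)
      then show ?thesis
        using that(2) unfolding jac_bm_power_texp by (intro mult_nonneg_nonneg) auto
    qed
    show "0 < eval_texp (jac (bm_power_texp 0) (bm_power_texp 1) (bm_power_texp 2) 1 2 3) u"
      unfolding jac_bm_power_texp u3 by (simp add: u_def sin34)
    show "eval_texp (bm_power_texp 0) u = 0" "eval_texp (bm_power_texp 1) u = 0"
      "eval_texp (bm_power_texp 2) u = 0"
      using S by (simp_all add: bm_power_texp_def u_def sin34 Let_def power2_eq_square)
  qed (use u3 in \<open>auto simp: u_def cube_def\<close>)
qed

end
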